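(* Fix $L\ge 0$ and a set $\tilde\Omega$ with $\Omega^L\subseteq\tilde\Omega\subseteq C([0,T],H)$. Let $u$ be a minimax $L$-subsolution and let $v$ be a minimax $L$-supersolution of (TVP) on $[0,T]\times\tilde\Omega$. Then $w$ defined by $w(t,x,y):=u(t,x)-v(t,y)$ is a viscosity $L$-subsolution of the doubled equation $$\partial_t w(t,x,y)-\langle A(t,x(t)),\partial_x w(t,x,y)\rangle-\langle A(t,y(t)),\partial_y w(t,x,y)\rangle+F(t,x,\partial_x w(t,x,y))-F(t,y,-\partial_y w(t,x,y))=0$$ on $[0,T]\times\tilde\Omega\times\tilde\Omega$.
   Context: Spaces. Let $T>0$. $H$ is a real Hilbert space with inner product $(\cdot,\cdot)$ and norm $|\cdot|$; $V$ is a separable reflexive Banach space with norm $\|\cdot\|$, continuously, densely and compactly embedded into $H$; $V^\ast$ is its dual with norm $\|\cdot\|_\ast$ and duality pairing $\langle x^\ast,x\rangle=x^\ast(x)$. With the usual identifications, $V\subseteq H\subseteq V^\ast$ and $\langle x,y\rangle=(x,y)$ for $x\in H$, $y\in V$. Fix $p\ge 2$, $q>1$ with $1/p+1/q=1$. For $t_0\in[0,T)$, $W_{pq}(t_0,T)$ is the space of all $\mathbf{x}\in L^p(t_0,T;V)$ possessing a generalized derivative $\mathbf{x}'\in L^q(t_0,T;V^\ast)$. Operator. $A:[0,T]\times V\to V^\ast$ is fixed and satisfies: (i) $t\mapsto\langle A(t,x),v\rangle$ is measurable for all $x,v\in V$; (ii) for a.e. $t$ and all $x,y\in V$, $\langle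 A(t,x)-A(t,y),x-y\rangle\ge 0$; (iii) for a.e. $t$ and all $x,y,v\in V$, $s\mapsto\langle A(t,x+sy),v\rangle$ is continuous on $[0,1]$; (iv) there are $a_1\in L^q(0,T)$, $c_1\ge0$ with $\|A(t,x)\|_\ast\le a_1(t)+c_1\|x\|^{p-1}$ for all $x\in V$ and a.e. $t$; (v) there is $c_2>0$ with $\langle A(t,x),x\rangle\ge c_2\|x\|^p$ for all $x\in V$ and a.e. $t$. Paths and continuity. $C([0,T],H)$ carries the sup norm. On $[0,T]\times C([0,T],H)$ and its subsets use the pseudo-metric $\mathbf{d}_\infty((t,x),(s,y))=|t-s|+\sup_{r\in[0,T]}|x(r\wedge t)-y(r\wedge s)|$, and on $[0,T]\times C([0,T],H)^2$ the analogous pseudo-metric with the pair of stopped paths; (semi-)continuity in $(t,x)$ or $(t,x,y)$ is meant with respect to these (so such functions are non-anticipating, i.e. their value at time $t$ depends only on the paths up to time $t$). USC and LSC denote real-valued upper and lower semicontinuous functions. Trajectories. For $L\ge 0$ and $(t_0,x_0)\in[0,T)\times C([0,T],H)$, $\mathcal{X}^L(t_0,x_0)$ is the set of all $x\in C([0,T],H)$ with $x=x_0$ on $[0,t_0]$ for which there exist $\mathbf{x}\in W_{pq}(t_0,T)$ and $f^x\in L^2(t_0,T;H)$ with $x=\mathbf{x}$ a.e. on $(t_0,T)$, $\mathbf{x}'(t)+A(t,\mathbf{x}(t))=f^x(t)$ a.e. on $(t_0,T)$, and $|f^x(t)|\le L(1+\sup_{0\le s\le t}|x(s)|)$ a.e.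 on $(t_0,T)$ ($\mathbf{x}$, $f^x$ are uniquely determined by $x$). Fix $x_\ast\in H$, regarded as a constant path, and put $\Omega^L:=\mathcal{X}^L(0,x_\ast)$. Data. $h:C([0,T],H)\to\mathbb{R}$ is continuous. $F:[0,T]\times C([0,T],H)\times H\to\mathbb{R}$ satisfies: (i) $F$ is continuous; (ii) there is $L_0\ge0$ with $|F(t,x,z)-F(t,x,\tilde z)|\le L_0(1+\sup_{0\le s\le t}|x(s)|)|z-\tilde z|$ for all $t,x,z,\tilde z$; (iii) for every $L\ge0$ and $(t_0,x_0)\in[0,T)\times C([0,T],H)$ there is a modulus of continuity $m_{L,t_0,x_0}$ such that for all $\varepsilon>0$, $t\in[t_0,T]$, $x,y\in\mathcal{X}^L(t_0,x_0)$: $F(t,x,\varepsilon^{-1}[x(t)-y(t)])-F(t,y,\varepsilon^{-1}[x(t)-y(t)])\le m_{L,t_0,x_0}(\varepsilon^{-1}|x(t)-y(t)|^2+\sup_{s\le t}|x(s)-y(s)|)$. (TVP) denotes the terminal-value problem $\partial_tu-\langle A(t,x(t)),\partial_xu\rangle+F(t,x,\partial_xu)=0$ on $[0,T)\times C([0,T],H)$, $u(T,x)=h(x)$. Minimax semisolutions. $u:[0,T]\times\tilde\Omega\to\mathbb{R}$ is a minimax $L$-subsolution (resp. $L$-supersolution) of (TVP) on $[0,T]\times\tilde\Omega$ if $u\in\mathrm{USC}([0,T]\times\tilde\Omega)$ (resp. $\mathrm{LSC}$), $u(T,\cdot)\le h$ (resp. $\ge h$) on $\tilde\Omega$, and for every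 $(t_0,x_0,z)\in[0,T)\times\tilde\Omega\times H$ there is $x\in\mathcal{X}^L(t_0,x_0)\cap\tilde\Omega$ such that for every $t\in[t_0,T]$: $u(t_0,x_0)\le$ (resp. $\ge$) $\int_{t_0}^t[(-f^x(s),z)+F(s,x,z)]\,ds+u(t,x)$. Test functions. For $t_\ast\in[0,T)$, $\mathcal{C}^{1,1}_V([t_\ast,T]\times C([0,T],H)^2)$ is the set of continuous $\varphi:[t_\ast,T]\times C([0,T],H)^2\to\mathbb{R}$ for which there exist continuous functions (path derivatives) $\partial_t\varphi$ (real-valued) and $\partial_x\varphi,\partial_y\varphi$ ($H$-valued) on the same domain such that: (a) for every pair $(x,y)$, $x(t)\in V$ implies $\partial_x\varphi(t,x,y)\in V$, and $y(t)\in V$ implies $\partial_y\varphi(t,x,y)\in V$, for a.e. $t\in(t_\ast,T)$; (b) for every $t_0\in[t_\ast,T)$, $x_0,y_0,x,y\in C([0,T],H)$ and $\mathbf{x},\mathbf{y}\in W_{pq}(t_0,T)$ with $x=x_0$, $y=y_0$ on $[0,t_0]$ and $x=\mathbf{x}$, $y=\mathbf{y}$ a.e. on $(t_0,T)$, and every $t\in[t_0,T]$, $\varphi(t,x,y)-\varphi(t_0,x_0,y_0)=\int_{t_0}^t\partial_t\varphi(s,x,y)+\langle\mathbf{x}'(s),\partial_x\varphi(s,x,y)\rangle+\langle\mathbf{y}'(s),\partial_y\varphi(s,x,y)\rangle\,ds$. Viscosity subsolution. For a non-anticipating $w:[0,T]\times\tilde\Omega\times\tilde\Omega\to\mathbb{R}$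 and $(t_0,x_0,y_0)\in[0,T)\times\tilde\Omega\times\tilde\Omega$, let $\underline{\mathcal{A}}^Lw(t_0,x_0,y_0)$ be the set of $\varphi\in\mathcal{C}^{1,1}_V([t_0,T]\times C([0,T],H)^2)$ for which there is $T_0\in(t_0,T]$ with $0=(\varphi-w)(t_0,x_0,y_0)=\inf(\varphi-w)$, the infimum being over $(t,x,y)\in[t_0,T_0]\times\mathcal{X}^L(t_0,x_0)\times\mathcal{X}^L(t_0,y_0)$. A function $w\in\mathrm{USC}([0,T]\times\tilde\Omega\times\tilde\Omega)$ is a viscosity $L$-subsolution of the doubled equation on $[0,T]\times\tilde\Omega\times\tilde\Omega$ if for every $(t_0,x_0,y_0)\in[0,T)\times\tilde\Omega\times\tilde\Omega$ and every $\varphi\in\underline{\mathcal{A}}^Lw(t_0,x_0,y_0)$ there is $(x,y)\in\mathcal{X}^L(t_0,x_0)\times\mathcal{X}^L(t_0,y_0)$ with $$\partial_t\varphi(t_0,x_0,y_0)+\limsup_{\delta\downarrow0}\frac1\delta\int_{t_0}^{t_0+\delta}\left[-\langle A(t,\mathbf{x}(t)),\partial_x\varphi(t,x,y)\rangle-\langle A(t,\mathbf{y}(t)),\partial_y\varphi(t,x,y)\rangle\right]dt+F(t_0,x_0,\partial_x\varphi(t_0,x_0,y_0))-F(t_0,y_0,-\partial_y\varphi(t_0,x_0,y_0))\ge0.$$ *)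

theory Defs
  imports "HOL-Analysis.Analysis"
begin

section \<open>The spaces\<close>

text \<open>
  The embedding of \<open>V\<close> into \<open>H\<close> is an explicit map \<open>j\<close>, and an element of \<open>H\<close> ``lies in \<open>V\<close>'' iff
  it is in \<open>range j\<close>; \<open>inv j\<close> then recovers it as an element of \<open>V\<close>. The dual of \<open>V\<close> is the type of
  bounded linear functionals on \<open>V\<close> with the operator norm.
\<close>

definition reflexive_space :: "'v::real_normed_vector itself \<Rightarrow> bool" where
  "reflexive_space _ \<longleftrightarrow>
     (\<forall>\<Phi> :: ('v \<Rightarrow>\<^sub>L real) \<Rightarrow>\<^sub>L real. \<exists>v :: 'v. \<forall>\<xi>. blinfun_apply \<Phi> \<xi> = blinfun_apply \<xi> v)"

definition gelfand_embedding :: "('v::banach \<Rightarrow> 'h::{real_inner,complete_space}) \<Rightarrow> bool" where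
  "gelfand_embedding j \<longleftrightarrow>
     separable_space (euclidean :: 'v topology) \<and> reflexive_space TYPE('v) \<and>
     bounded_linear j \<and> inj j \<and> closure (range j) = UNIV \<and>
     (\<forall>B. bounded B \<longrightarrow> compact (closure (j ` B)))"

text \<open>The identification of an element of \<open>H\<close> with a functional on \<open>V\<close>.\<close>

definition H_to_dual :: "('v::banach \<Rightarrow> 'h::{real_inner,complete_space}) \<Rightarrow> 'h \<Rightarrow> ('v \<Rightarrow>\<^sub>L real)" where
  "H_to_dual j h = Blinfun (\<lambda>v. inner h (j v))"

text \<open>
  Vector-valued functions are treated as representatives. All target spaces used below are
  separable (\<open>V\<close> by assumption, \<open>H\<close> by density, the dual by reflexivity), so that Borel and strong
  measurability coincide.
\<close>

definition Lp_fun :: "real \<Rightarrow> real \<Rightarrow> real \<Rightarrow> (real \<Rightarrow> 'a::real_normed_vector) \<Rightarrow> bool" where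
  "Lp_fun r a b f \<longleftrightarrow>
     f \<in> borel_measurable (lebesgue_on {a<..<b}) \<and>
     integrable (lebesgue_on {a<..<b}) (\<lambda>t. norm (f t) powr r)"

text \<open>\<open>C\<^sub>c\<^sup>\<infinity>(a,b)\<close>, extended by zero to the real line.\<close>

definition test_fun :: "real \<Rightarrow> real \<Rightarrow> (real \<Rightarrow> real) \<Rightarrow> bool" where
  "test_fun a b \<eta> \<longleftrightarrow>
     (\<forall>n t. ((deriv ^^ n) \<eta>) differentiable (at t)) \<and>
     (\<exists>c d. a < c \<and> d < b \<and> (\<forall>t. t \<notin> {c..d} \<longrightarrow> \<eta> t = 0))"

text \<open>
  \<open>\<integral> \<eta>'(t) X(t) dt = - \<integral> \<eta>(t) G(t) dt\<close> as an identity of Bochner integrals in the dual of \<open>V\<close>, where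
  \<open>X(t)\<close> is identified with a functional. It is written after application to an arbitrary \<open>v\<close>, which
  commutes with the Bochner integral (the dual is not of class second-countable in the library,
  so its Bochner integral is not available there).
\<close>

definition generalized_derivative ::
  "('v::banach \<Rightarrow> 'h::{real_inner,complete_space}) \<Rightarrow> real \<Rightarrow> real \<Rightarrow> (real \<Rightarrow> 'v) \<Rightarrow> (real \<Rightarrow> 'v \<Rightarrow>\<^sub>L real) \<Rightarrow> bool" where
  "generalized_derivative j a b X G \<longleftrightarrow>
     (\<forall>\<eta> v. test_fun a b \<eta> \<longrightarrow>
        (LINT t|lebesgue_on {a<..<b}. deriv \<eta> t * blinfun_apply (H_to_dual j (j (X t))) v)
        = - (LINT t|lebesgue_on {a<..<b}. \<eta> t * blinfun_apply (G t) v))"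

text \<open>\<open>X \<in> W\<^sub>p\<^sub>q(t\<^sub>0,T)\<close> with generalized derivative \<open>G\<close>.\<close>

definition Wpq ::
  "real \<Rightarrow> real \<Rightarrow> real \<Rightarrow> ('v::banach \<Rightarrow> 'h::{real_inner,complete_space}) \<Rightarrow> real \<Rightarrow>
   (real \<Rightarrow> 'v) \<Rightarrow> (real \<Rightarrow> 'v \<Rightarrow>\<^sub>L real) \<Rightarrow> bool" where
  "Wpq T p q j t0 X G \<longleftrightarrow>
     Lp_fun p t0 T X \<and> Lp_fun q t0 T G \<and> generalized_derivative j t0 T X G"


section \<open>The operator\<close>

definition monotone_coercive_operator ::
  "real \<Rightarrow> real \<Rightarrow> real \<Rightarrow> (real \<Rightarrow> 'v::banach \<Rightarrow> 'v \<Rightarrow>\<^sub>L real) \<Rightarrow> bool" where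
  "monotone_coercive_operator T p q A \<longleftrightarrow>
     (\<forall>x v. (\<lambda>t. blinfun_apply (A t x) v) \<in> borel_measurable (lebesgue_on {0..T})) \<and>
     (AE t in lebesgue_on {0..T}. \<forall>x y. blinfun_apply (A t x - A t y) (x - y) \<ge> 0) \<and>
     (AE t in lebesgue_on {0..T}. \<forall>x y v.
        continuous_on {0..1} (\<lambda>s. blinfun_apply (A t (x + s *\<^sub>R y)) v)) \<and>
     (\<exists>a\<^sub>1 c\<^sub>1. Lp_fun q 0 T a\<^sub>1 \<and> c\<^sub>1 \<ge> 0 \<and>
        (AE t in lebesgue_on {0..T}. \<forall>x. norm (A t x) \<le> a\<^sub>1 t + c\<^sub>1 * norm x powr (p - 1))) \<and>
     (\<exists>c\<^sub>2>0. AE t in lebesgue_on {0..T}. \<forall>x. blinfun_apply (A t x) x \<ge> c\<^sub>2 * norm x powr p)"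


section \<open>Paths and continuity\<close>

text \<open>\<open>C([0,T],H)\<close>; extensionality makes each continuous path on \<open>[0,T]\<close> exactly one function.\<close>

definition paths :: "real \<Rightarrow> (real \<Rightarrow> 'h::real_normed_vector) set" where
  "paths T = {x. continuous_on {0..T} x \<and> x \<in> extensional {0..T}}"

definition sup_dist :: "real \<Rightarrow> (real \<Rightarrow> 'h::real_normed_vector) \<Rightarrow> (real \<Rightarrow> 'h) \<Rightarrow> real" where
  "sup_dist T x y = (SUP r\<in>{0..T}. norm (x r - y r))"

definition d_inf ::
  "real \<Rightarrow> real \<times> (real \<Rightarrow> 'h::real_normed_vector) \<Rightarrow> real \<times> (real \<Rightarrow> 'h) \<Rightarrow> real" where
  "d_inf T = (\<lambda>(t, x) (s, y). \<bar>t - s\<bar> + (SUP r\<in>{0..T}. norm (x (min r t) - y (min r s))))"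

text \<open>A pair of paths is regarded as one path in the product Hilbert space.\<close>

definition d_inf_pair ::
  "real \<Rightarrow> real \<times> (real \<Rightarrow> 'h::real_normed_vector) \<times> (real \<Rightarrow> 'h) \<Rightarrow> real \<times> (real \<Rightarrow> 'h) \<times> (real \<Rightarrow> 'h) \<Rightarrow> real" where
  "d_inf_pair T = (\<lambda>(t, x, y) (s, x', y').
     d_inf T (t, \<lambda>r. (x r, y r)) (s, \<lambda>r. (x' r, y' r)))"

definition d_inf_vec ::
  "real \<Rightarrow> real \<times> (real \<Rightarrow> 'h::real_normed_vector) \<times> 'h \<Rightarrow> real \<times> (real \<Rightarrow> 'h) \<times> 'h \<Rightarrow> real" where
  "d_inf_vec T = (\<lambda>(t, x, z) (s, y, z'). d_inf T (t, x) (s, y) + norm (z - z'))"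

text \<open>(Semi-)continuity on \<open>D\<close> with respect to a pseudo-metric \<open>d\<close>.\<close>

definition pm_continuous :: "('a \<Rightarrow> 'a \<Rightarrow> real) \<Rightarrow> 'a set \<Rightarrow> ('a \<Rightarrow> 'b::metric_space) \<Rightarrow> bool" where
  "pm_continuous d D f \<longleftrightarrow>
     (\<forall>a\<in>D. \<forall>\<epsilon>>0. \<exists>\<delta>>0. \<forall>b\<in>D. d a b < \<delta> \<longrightarrow> dist (f b) (f a) < \<epsilon>)"

definition pm_usc :: "('a \<Rightarrow> 'a \<Rightarrow> real) \<Rightarrow> 'a set \<Rightarrow> ('a \<Rightarrow> real) \<Rightarrow> bool" where
  "pm_usc d D f \<longleftrightarrow>
     (\<forall>a\<in>D. \<forall>\<epsilon>>0. \<exists>\<delta>>0. \<forall>b\<in>D. d a b < \<delta> \<longrightarrow> f b < f a + \<epsilon>)"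

definition pm_lsc :: "('a \<Rightarrow> 'a \<Rightarrow> real) \<Rightarrow> 'a set \<Rightarrow> ('a \<Rightarrow> real) \<Rightarrow> bool" where
  "pm_lsc d D f \<longleftrightarrow>
     (\<forall>a\<in>D. \<forall>\<epsilon>>0. \<exists>\<delta>>0. \<forall>b\<in>D. d a b < \<delta> \<longrightarrow> f b > f a - \<epsilon>)"


section \<open>Trajectories\<close>

text \<open>
  \<open>x \<in> \<X>\<^sup>L(t\<^sub>0,x\<^sub>0)\<close> with \<open>V\<close>-valued representative \<open>X\<close> and forcing term \<open>f = f\<^sup>x\<close>. The last two are
  determined by \<open>x\<close> up to null sets only, hence the relational form.
\<close>

definition trajectory ::
  "real \<Rightarrow> real \<Rightarrow> real \<Rightarrow> ('v::banach \<Rightarrow> 'h::{real_inner,complete_space}) \<Rightarrow> (real \<Rightarrow> 'v \<Rightarrow> 'v \<Rightarrow>\<^sub>L real) \<Rightarrow>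
   real \<Rightarrow> real \<Rightarrow> (real \<Rightarrow> 'h) \<Rightarrow> (real \<Rightarrow> 'h) \<Rightarrow> (real \<Rightarrow> 'v) \<Rightarrow> (real \<Rightarrow> 'h) \<Rightarrow> bool" where
  "trajectory T p q j A L t0 x0 x X f \<longleftrightarrow>
     x \<in> paths T \<and> (\<forall>t\<in>{0..t0}. x t = x0 t) \<and>
     Lp_fun 2 t0 T f \<and>
     (AE t in lebesgue_on {t0<..<T}. x t = j (X t)) \<and>
     (\<exists>G. Wpq T p q j t0 X G \<and>
        (AE t in lebesgue_on {t0<..<T}. G t + A t (X t) = H_to_dual j (f t))) \<and>
     (AE t in lebesgue_on {t0<..<T}. norm (f t) \<le> L * (1 + (SUP s\<in>{0..t}. norm (x s))))"

definition trajectories ::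
  "real \<Rightarrow> real \<Rightarrow> real \<Rightarrow> ('v::banach \<Rightarrow> 'h::{real_inner,complete_space}) \<Rightarrow> (real \<Rightarrow> 'v \<Rightarrow> 'v \<Rightarrow>\<^sub>L real) \<Rightarrow>
   real \<Rightarrow> real \<Rightarrow> (real \<Rightarrow> 'h) \<Rightarrow> (real \<Rightarrow> 'h) set" where
  "trajectories T p q j A L t0 x0 = {x. \<exists>X f. trajectory T p q j A L t0 x0 x X f}"

definition Omega ::
  "real \<Rightarrow> real \<Rightarrow> real \<Rightarrow> ('v::banach \<Rightarrow> 'h::{real_inner,complete_space}) \<Rightarrow> (real \<Rightarrow> 'v \<Rightarrow> 'v \<Rightarrow>\<^sub>L real) \<Rightarrow>
   'h \<Rightarrow> real \<Rightarrow> (real \<Rightarrow> 'h) set" where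
  "Omega T p q j A xstar L = trajectories T p q j A L 0 (restrict (\<lambda>_. xstar) {0..T})"


section \<open>The data\<close>

definition modulus_of_continuity :: "(real \<Rightarrow> real) \<Rightarrow> bool" where
  "modulus_of_continuity m \<longleftrightarrow> mono_on {0..} m \<and> m 0 = 0 \<and> (m \<longlongrightarrow> 0) (at_right 0)"

definition admissible_hamiltonian ::
  "real \<Rightarrow> real \<Rightarrow> real \<Rightarrow> ('v::banach \<Rightarrow> 'h::{real_inner,complete_space}) \<Rightarrow> (real \<Rightarrow> 'v \<Rightarrow> 'v \<Rightarrow>\<^sub>L real) \<Rightarrow>
   (real \<Rightarrow> (real \<Rightarrow> 'h) \<Rightarrow> 'h \<Rightarrow> real) \<Rightarrow> bool" where
  "admissible_hamiltonian T p q j A F \<longleftrightarrow>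
     pm_continuous (d_inf_vec T) ({0..T} \<times> paths T \<times> UNIV) (\<lambda>(t, x, z). F t x z) \<and>
     (\<exists>L\<^sub>0\<ge>0. \<forall>t\<in>{0..T}. \<forall>x\<in>paths T. \<forall>z z'.
        \<bar>F t x z - F t x z'\<bar> \<le> L\<^sub>0 * (1 + (SUP s\<in>{0..t}. norm (x s))) * norm (z - z')) \<and>
     (\<forall>L\<ge>0. \<forall>t0\<in>{0..<T}. \<forall>x0\<in>paths T. \<exists>m. modulus_of_continuity m \<and>
        (\<forall>\<epsilon>>0. \<forall>t\<in>{t0..T}.
         \<forall>x\<in>trajectories T p q j A L t0 x0. \<forall>y\<in>trajectories T p q j A L t0 x0.
           F t x ((1 / \<epsilon>) *\<^sub>R (x t - y t)) - F t y ((1 / \<epsilon>) *\<^sub>R (x t - y t))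
           \<le> m (1 / \<epsilon> * (norm (x t - y t))\<^sup>2 + (SUP s\<in>{0..t}. norm (x s - y s)))))"


section \<open>Minimax semisolutions\<close>

definition minimax_subsolution ::
  "real \<Rightarrow> real \<Rightarrow> real \<Rightarrow> ('v::banach \<Rightarrow> 'h::{real_inner,complete_space}) \<Rightarrow> (real \<Rightarrow> 'v \<Rightarrow> 'v \<Rightarrow>\<^sub>L real) \<Rightarrow>
   (real \<Rightarrow> (real \<Rightarrow> 'h) \<Rightarrow> 'h \<Rightarrow> real) \<Rightarrow> ((real \<Rightarrow> 'h) \<Rightarrow> real) \<Rightarrow> real \<Rightarrow> (real \<Rightarrow> 'h) set \<Rightarrow>
   (real \<Rightarrow> (real \<Rightarrow> 'h) \<Rightarrow> real) \<Rightarrow> bool" where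
  "minimax_subsolution T p q j A F h L \<Omega> u \<longleftrightarrow>
     pm_usc (d_inf T) ({0..T} \<times> \<Omega>) (\<lambda>(t, x). u t x) \<and>
     (\<forall>x\<in>\<Omega>. u T x \<le> h x) \<and>
     (\<forall>t0\<in>{0..<T}. \<forall>x0\<in>\<Omega>. \<forall>z. \<exists>x X f.
        trajectory T p q j A L t0 x0 x X f \<and> x \<in> \<Omega> \<and>
        (\<forall>t\<in>{t0..T}.
           u t0 x0 \<le> (LINT s|lebesgue_on {t0..t}. inner (- f s) z + F s x z) + u t x))"

definition minimax_supersolution ::
  "real \<Rightarrow> real \<Rightarrow> real \<Rightarrow> ('v::banach \<Rightarrow> 'h::{real_inner,complete_space}) \<Rightarrow> (real \<Rightarrow> 'v \<Rightarrow> 'v \<Rightarrow>\<^sub>L real) \<Rightarrow>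
   (real \<Rightarrow> (real \<Rightarrow> 'h) \<Rightarrow> 'h \<Rightarrow> real) \<Rightarrow> ((real \<Rightarrow> 'h) \<Rightarrow> real) \<Rightarrow> real \<Rightarrow> (real \<Rightarrow> 'h) set \<Rightarrow>
   (real \<Rightarrow> (real \<Rightarrow> 'h) \<Rightarrow> real) \<Rightarrow> bool" where
  "minimax_supersolution T p q j A F h L \<Omega> v \<longleftrightarrow>
     pm_lsc (d_inf T) ({0..T} \<times> \<Omega>) (\<lambda>(t, x). v t x) \<and>
     (\<forall>x\<in>\<Omega>. v T x \<ge> h x) \<and>
     (\<forall>t0\<in>{0..<T}. \<forall>x0\<in>\<Omega>. \<forall>z. \<exists>x X f.
        trajectory T p q j A L t0 x0 x X f \<and> x \<in> \<Omega> \<and>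
        (\<forall>t\<in>{t0..T}.
           v t0 x0 \<ge> (LINT s|lebesgue_on {t0..t}. inner (- f s) z + F s x z) + v t x))"


section \<open>Test functions and viscosity subsolutions\<close>

text \<open>
  \<open>\<phi> \<in> \<C>\<^sup>1\<^sup>,\<^sup>1\<^sub>V([t\<^sub>*,T] \<times> C([0,T],H)\<^sup>2)\<close> with path derivatives \<open>\<phi>t\<close>, \<open>\<phi>x\<close>, \<open>\<phi>y\<close>. The existence of the integral
  in the chain rule is stated explicitly because the library integral of a non-integrable function
  is \<open>0\<close>. Under the almost everywhere conditions on \<open>x\<close> and \<open>y\<close>, the values of \<open>\<phi>x\<close> and \<open>\<phi>y\<close> occurring
  there are in \<open>range j\<close> for almost every \<open>s\<close>.
\<close>

definition C11V ::
  "real \<Rightarrow> real \<Rightarrow> real \<Rightarrow> ('v::banach \<Rightarrow> 'h::{real_inner,complete_space}) \<Rightarrow> real \<Rightarrow>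
   (real \<Rightarrow> (real \<Rightarrow> 'h) \<Rightarrow> (real \<Rightarrow> 'h) \<Rightarrow> real) \<Rightarrow> (real \<Rightarrow> (real \<Rightarrow> 'h) \<Rightarrow> (real \<Rightarrow> 'h) \<Rightarrow> real) \<Rightarrow>
   (real \<Rightarrow> (real \<Rightarrow> 'h) \<Rightarrow> (real \<Rightarrow> 'h) \<Rightarrow> 'h) \<Rightarrow> (real \<Rightarrow> (real \<Rightarrow> 'h) \<Rightarrow> (real \<Rightarrow> 'h) \<Rightarrow> 'h) \<Rightarrow> bool" where
  "C11V T p q j tstar \<phi> \<phi>t \<phi>x \<phi>y \<longleftrightarrow>
     (let D = {tstar..T} \<times> paths T \<times> paths T in
        pm_continuous (d_inf_pair T) D (\<lambda>(t, x, y). \<phi> t x y) \<and>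
        pm_continuous (d_inf_pair T) D (\<lambda>(t, x, y). \<phi>t t x y) \<and>
        pm_continuous (d_inf_pair T) D (\<lambda>(t, x, y). \<phi>x t x y) \<and>
        pm_continuous (d_inf_pair T) D (\<lambda>(t, x, y). \<phi>y t x y)) \<and>
     (\<forall>x\<in>paths T. \<forall>y\<in>paths T. AE t in lebesgue_on {tstar<..<T}.
        (x t \<in> range j \<longrightarrow> \<phi>x t x y \<in> range j) \<and> (y t \<in> range j \<longrightarrow> \<phi>y t x y \<in> range j)) \<and>
     (\<forall>t0\<in>{tstar..<T}. \<forall>x0\<in>paths T. \<forall>y0\<in>paths T. \<forall>x\<in>paths T. \<forall>y\<in>paths T. \<forall>X Y GX GY.
        Wpq T p q j t0 X GX \<and> Wpq T p q j t0 Y GY \<and>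
        (\<forall>t\<in>{0..t0}. x t = x0 t \<and> y t = y0 t) \<and>
        (AE t in lebesgue_on {t0<..<T}. x t = j (X t) \<and> y t = j (Y t)) \<longrightarrow>
        (\<forall>t\<in>{t0..T}.
           let g = (\<lambda>s. \<phi>t s x y + blinfun_apply (GX s) (inv j (\<phi>x s x y))
                                 + blinfun_apply (GY s) (inv j (\<phi>y s x y)))
           in integrable (lebesgue_on {t0..t}) g \<and>
              \<phi> t x y - \<phi> t0 x0 y0 = (LINT s|lebesgue_on {t0..t}. g s)))"

text \<open>
  \<open>\<phi> \<in> \<A>\<^sup>Lw(t\<^sub>0,x\<^sub>0,y\<^sub>0)\<close>, with path derivatives \<open>\<phi>t\<close>, \<open>\<phi>x\<close>, \<open>\<phi>y\<close>. As \<open>w\<close> is only defined for paths in \<open>\<Omega>\<close>, the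
  infimum is over the trajectories in \<open>\<Omega>\<close>.
\<close>

definition touching_above ::
  "real \<Rightarrow> real \<Rightarrow> real \<Rightarrow> ('v::banach \<Rightarrow> 'h::{real_inner,complete_space}) \<Rightarrow> (real \<Rightarrow> 'v \<Rightarrow> 'v \<Rightarrow>\<^sub>L real) \<Rightarrow>
   real \<Rightarrow> (real \<Rightarrow> 'h) set \<Rightarrow> (real \<Rightarrow> (real \<Rightarrow> 'h) \<Rightarrow> (real \<Rightarrow> 'h) \<Rightarrow> real) \<Rightarrow>
   real \<Rightarrow> (real \<Rightarrow> 'h) \<Rightarrow> (real \<Rightarrow> 'h) \<Rightarrow>
   (real \<Rightarrow> (real \<Rightarrow> 'h) \<Rightarrow> (real \<Rightarrow> 'h) \<Rightarrow> real) \<Rightarrow> (real \<Rightarrow> (real \<Rightarrow> 'h) \<Rightarrow> (real \<Rightarrow> 'h) \<Rightarrow> real) \<Rightarrow>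
   (real \<Rightarrow> (real \<Rightarrow> 'h) \<Rightarrow> (real \<Rightarrow> 'h) \<Rightarrow> 'h) \<Rightarrow> (real \<Rightarrow> (real \<Rightarrow> 'h) \<Rightarrow> (real \<Rightarrow> 'h) \<Rightarrow> 'h) \<Rightarrow> bool" where
  "touching_above T p q j A L \<Omega> w t0 x0 y0 \<phi> \<phi>t \<phi>x \<phi>y \<longleftrightarrow>
     C11V T p q j t0 \<phi> \<phi>t \<phi>x \<phi>y \<and>
     (\<exists>T\<^sub>0\<in>{t0<..T}.
        \<phi> t0 x0 y0 - w t0 x0 y0 = 0 \<and>
        (INF (t, x, y) \<in> {t0..T\<^sub>0} \<times> (trajectories T p q j A L t0 x0 \<inter> \<Omega>)
                                 \<times> (trajectories T p q j A L t0 y0 \<inter> \<Omega>).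
           ereal (\<phi> t x y - w t x y)) = 0)"

definition viscosity_subsolution_doubled ::
  "real \<Rightarrow> real \<Rightarrow> real \<Rightarrow> ('v::banach \<Rightarrow> 'h::{real_inner,complete_space}) \<Rightarrow> (real \<Rightarrow> 'v \<Rightarrow> 'v \<Rightarrow>\<^sub>L real) \<Rightarrow>
   (real \<Rightarrow> (real \<Rightarrow> 'h) \<Rightarrow> 'h \<Rightarrow> real) \<Rightarrow> real \<Rightarrow> (real \<Rightarrow> 'h) set \<Rightarrow>
   (real \<Rightarrow> (real \<Rightarrow> 'h) \<Rightarrow> (real \<Rightarrow> 'h) \<Rightarrow> real) \<Rightarrow> bool" where
  "viscosity_subsolution_doubled T p q j A F L \<Omega> w \<longleftrightarrow>
     pm_usc (d_inf_pair T) ({0..T} \<times> \<Omega> \<times> \<Omega>) (\<lambda>(t, x, y). w t x y) \<and>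
     (\<forall>t0\<in>{0..<T}. \<forall>x0\<in>\<Omega>. \<forall>y0\<in>\<Omega>. \<forall>\<phi> \<phi>t \<phi>x \<phi>y.
        touching_above T p q j A L \<Omega> w t0 x0 y0 \<phi> \<phi>t \<phi>x \<phi>y \<longrightarrow>
        (\<exists>x X f y Y g.
           trajectory T p q j A L t0 x0 x X f \<and> trajectory T p q j A L t0 y0 y Y g \<and>
           ereal (\<phi>t t0 x0 y0)
           + Limsup (at_right 0) (\<lambda>\<delta>. ereal (1 / \<delta> * (LINT t|lebesgue_on {t0..t0 + \<delta>}.
               - blinfun_apply (A t (X t)) (inv j (\<phi>x t x y))
               - blinfun_apply (A t (Y t)) (inv j (\<phi>y t x y)))))
           + ereal (F t0 x0 (\<phi>x t0 x0 y0)) - ereal (F t0 y0 (- \<phi>y t0 x0 y0)) \<ge> 0))"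

end

theory Submission
  imports Defs
begin

text \<open>
  Let \<open>\<phi>\<close> touch \<open>w = u - v\<close> from above at \<open>(t\<^sub>0, x\<^sub>0, y\<^sub>0)\<close>. Put \<open>z = \<partial>\<^sub>x\<phi>(t\<^sub>0, x\<^sub>0, y\<^sub>0)\<close> and
  \<open>z' = - \<partial>\<^sub>y\<phi>(t\<^sub>0, x\<^sub>0, y\<^sub>0)\<close>, let \<open>x\<close> be the trajectory that the subsolution \<open>u\<close> provides for the direction
  \<open>z\<close>, and \<open>y\<close> the one that the supersolution \<open>v\<close> provides for \<open>z'\<close>. Both lie in \<open>\<Omega>\<close>, so \<open>w \<le> \<phi>\<close> along
  \<open>(x, y)\<close> with equality at \<open>t\<^sub>0\<close>, and subtracting the two minimax inequalities gives
    \<open>\<phi>(t, x, y) - \<phi>(t\<^sub>0, x\<^sub>0, y\<^sub>0) \<ge> \<integral> (f, z) - F(s, x, z) - (g, z') + F(s, y, z') ds\<close>,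
  the integral being over \<open>[t\<^sub>0, t]\<close>, with \<open>f\<close>, \<open>g\<close> the forcing terms of \<open>x\<close>, \<open>y\<close>.
  The chain rule for \<open>\<phi>\<close> together with the evolution equations \<open>x' = f - A(x)\<close>, \<open>y' = g - A(y)\<close>
  (\<open>chain_rule_along_trajectories\<close>) writes the left-hand side as
    \<open>\<integral> -\<langle>A(x), \<partial>\<^sub>x\<phi>\<rangle> - \<langle>A(y), \<partial>\<^sub>y\<phi>\<rangle> ds + \<integral> \<partial>\<^sub>t\<phi> + (f, \<partial>\<^sub>x\<phi>) + (g, \<partial>\<^sub>y\<phi>) ds\<close>.

  Hence the integral of the \<open>A\<close>-terms is at least the integral of
    \<open>F(s, y, z') - F(s, x, z) - \<partial>\<^sub>t\<phi> - (f, \<partial>\<^sub>x\<phi> - z) - (g, \<partial>\<^sub>y\<phi> + z')\<close>.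
  The forcing terms are only measurable in time, but they are bounded almost everywhere by constants \<open>M\<close>, \<open>N\<close>, and
  \<open>\<partial>\<^sub>x\<phi> - z\<close>, \<open>\<partial>\<^sub>y\<phi> + z'\<close> tend to \<open>0\<close> as \<open>s\<close> decreases to \<open>t\<^sub>0\<close>. Replacing the last two products by
  \<open>M |\<partial>\<^sub>x\<phi> - z| + N |\<partial>\<^sub>y\<phi> + z'|\<close> therefore gives a lower bound that is continuous in \<open>s\<close>
  (\<open>touching_difference_integral_bound\<close>), and whose value at \<open>t\<^sub>0\<close> is
  \<open>F(t\<^sub>0, y\<^sub>0, z') - F(t\<^sub>0, x\<^sub>0, z) - \<partial>\<^sub>t\<phi>(t\<^sub>0, x\<^sub>0, y\<^sub>0)\<close>. Dividing by \<open>\<delta> = t - t\<^sub>0\<close> and letting \<open>\<delta>\<close> decrease to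
  \<open>0\<close> yields the viscosity inequality (\<open>eventually_average_ge\<close>).
\<close>

section \<open>Lebesgue integrals on real intervals\<close>

lemma AE_lebesgue_on_Icc:
  fixes a b c :: real
  assumes "AE s in lebesgue_on {a<..<b}. P s" and "c \<le> b"
  shows "AE s in lebesgue_on {a..c}. P s"
proof -
  have "AE s in lebesgue. s \<in> {a<..<b} \<longrightarrow> P s"
    using assms(1) by (simp add: AE_restrict_space_iff)
  moreover have "AE s in lebesgue. s \<noteq> a" "AE s in lebesgue. s \<noteq> b"
    by (intro AE_completion AE_lborel_singleton)+
  ultimately have "AE s in lebesgue. s \<in> {a..c} \<longrightarrow> P s"
    by eventually_elim (use assms(2) in auto)
  then show ?thesis
    by (simp add: AE_restrict_space_iff)
qed

text \<open>
  By completeness of Lebesgue measure, \<open>g\<close> need not be assumed measurable. This matters because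
  the sum of the two \<open>A\<close>-terms is only known to agree almost everywhere with an integrable function.
\<close>

lemma integrable_lebesgue_on_cong_AE:
  fixes f g :: "real \<Rightarrow> real"
  assumes S: "S \<in> sets lebesgue" and f: "integrable (lebesgue_on S) f"
    and eq: "AE s in lebesgue_on S. g s = f s"
  shows "integrable (lebesgue_on S) g"
    and "integral\<^sup>L (lebesgue_on S) g = integral\<^sup>L (lebesgue_on S) f"
proof -
  have "AE s in lebesgue. s \<in> S \<longrightarrow> g s = f s"
    using eq S by (simp add: AE_restrict_space_iff)
  then obtain N where N: "N \<in> null_sets lebesgue" "\<And>s. s \<in> S - N \<Longrightarrow> g s = f s"
    by (auto simp: eventually_ae_filter subset_eq)
  have "g absolutely_integrable_on S"
  proof (rule absolutely_integrable_spike)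
    show "f absolutely_integrable_on S"
      using f S by (simp add: integrable_restrict_space set_integrable_def)
    show "negligible N"
      using N by (simp add: negligible_iff_null_sets)
  qed (use N in auto)
  then show g: "integrable (lebesgue_on S) g"
    using S by (simp add: integrable_restrict_space set_integrable_def)
  show "integral\<^sup>L (lebesgue_on S) g = integral\<^sup>L (lebesgue_on S) f"
    by (rule integral_cong_AE) (use f g eq in auto)
qed

lemma integrable_continuous_lebesgue_on:
  fixes c :: "real \<Rightarrow> real"
  assumes "continuous_on {a..b} c"
  shows "integrable (lebesgue_on {a..b}) c"
  using absolutely_integrable_continuous_real[OF assms]
  by (simp add: integrable_restrict_space set_integrable_def)

text \<open>
  The target space is not of class \<open>second_countable_topology\<close>, so that the joint measurability of
  the inner product cannot be used. The continuous factor is instead approximated by step functions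
  in time, which reduces the claim to inner products with fixed vectors.
\<close>

lemma borel_measurable_inner_continuous:
  fixes f c :: "real \<Rightarrow> 'h::real_inner"
  assumes f: "f \<in> borel_measurable (lebesgue_on S)" and c: "continuous_on UNIV c"
  shows "(\<lambda>s. inner (f s) (c s)) \<in> borel_measurable (lebesgue_on S)"
proof (rule borel_measurable_LIMSEQ_real)
  \<comment> \<open>The \<open>n\<close>-th approximation evaluates \<open>c\<close> at the grid point of mesh \<open>1 / (n + 1)\<close> below \<open>s\<close>.\<close>
  fix n :: nat
  have 1: "(\<lambda>s. inner (f s) (c (of_int i / real (Suc n)))) \<in> borel_measurable (lebesgue_on S)" for i :: int
    by (rule measurable_compose[OF f]) (intro borel_measurable_continuous_onI continuous_intros)
  have "(\<lambda>s::real. s) \<in> borel_measurable (lebesgue_on S)"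
    using id_borel_measurable_lebesgue_on[of S] by (simp add: id_def)
  then have 2: "(\<lambda>s. \<lfloor>real (Suc n) * s\<rfloor>) \<in> lebesgue_on S \<rightarrow>\<^sub>M count_space UNIV"
    by measurable
  show "(\<lambda>s. inner (f s) (c (of_int \<lfloor>real (Suc n) * s\<rfloor> / real (Suc n)))) \<in> borel_measurable (lebesgue_on S)"
    using measurable_compose_countable[OF 1 2] .
next
  fix s
  have "(\<lambda>n. of_int \<lfloor>real (Suc n) * s\<rfloor> / real (Suc n)) \<longlonglongrightarrow> s"
  proof (rule real_tendsto_sandwich)
    show "\<forall>\<^sub>F n in sequentially. s - inverse (real (Suc n)) \<le> of_int \<lfloor>real (Suc n) * s\<rfloor> / real (Suc n)"
    proof (intro always_eventually allI)
      fix n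
      have "real (Suc n) * s - 1 \<le> of_int \<lfloor>real (Suc n) * s\<rfloor>" by linarith
      then have "(real (Suc n) * s - 1) / real (Suc n) \<le> of_int \<lfloor>real (Suc n) * s\<rfloor> / real (Suc n)"
        by (intro divide_right_mono) auto
      then show "s - inverse (real (Suc n)) \<le> of_int \<lfloor>real (Suc n) * s\<rfloor> / real (Suc n)"
        by (simp add: diff_divide_distrib inverse_eq_divide del: of_nat_Suc)
    qed
    show "\<forall>\<^sub>F n in sequentially. of_int \<lfloor>real (Suc n) * s\<rfloor> / real (Suc n) \<le> s"
    proof (intro always_eventually allI)
      fix n
      have "of_int \<lfloor>real (Suc n) * s\<rfloor> \<le> real (Suc n) * s" by linarith
      then show "of_int \<lfloor>real (Suc n) * s\<rfloor> / real (Suc n) \<le> s"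
        by (simp add: field_simps del: of_nat_Suc)
    qed
    show "(\<lambda>n. s - inverse (real (Suc n))) \<longlonglongrightarrow> s"
      using tendsto_diff[OF tendsto_const[of s] LIMSEQ_inverse_real_of_nat] by simp
  qed simp
  moreover have "isCont c s"
    using c by (simp add: continuous_on_eq_continuous_at)
  ultimately have "(\<lambda>n. c (of_int \<lfloor>real (Suc n) * s\<rfloor> / real (Suc n))) \<longlonglongrightarrow> c s"
    by (rule isCont_tendsto_compose[rotated])
  then show "(\<lambda>n. inner (f s) (c (of_int \<lfloor>real (Suc n) * s\<rfloor> / real (Suc n)))) \<longlonglongrightarrow> inner (f s) (c s)"
    by (intro tendsto_intros)
qed

lemma integrable_inner_continuous:
  fixes f c :: "real \<Rightarrow> 'h::real_inner"
  assumes f: "f \<in> borel_measurable (lebesgue_on {a<..<b})"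
    and M: "AE s in lebesgue_on {a<..<b}. norm (f s) \<le> M"
    and c: "continuous_on {a..b} c" and t: "t \<in> {a..b}"
  shows "integrable (lebesgue_on {a..t}) (\<lambda>s. inner (f s) (c s))"
proof -
  \<comment> \<open>Extend \<open>c\<close> from \<open>{a..b}\<close> to a continuous function on the whole line.\<close>
  define c' where "c' s = c (max a (min b s))" for s
  have c'_eq: "c' s = c s" if "s \<in> {a..b}" for s
  proof -
    have "max a (min b s) = s" using that by auto
    then show ?thesis by (simp add: c'_def)
  qed
  have c': "continuous_on UNIV c'"
    unfolding c'_def
    by (rule continuous_on_compose2[OF c]) (use t in \<open>auto intro!: continuous_intros\<close>)
  obtain B where B: "\<And>s. s \<in> {a..b} \<Longrightarrow> norm (c s) \<le> B"
    using compact_imp_bounded[OF compact_continuous_image[OF c compact_Icc]]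
    unfolding bounded_iff by blast
  have "integrable (lebesgue_on {a<..<b}) (\<lambda>s. inner (f s) (c' s))"
  proof (rule finite_measure.integrable_const_bound)
    show "finite_measure (lebesgue_on {a<..<b})"
      by (intro finite_measure_lebesgue_on) (use bounded_set_imp_lmeasurable in auto)
    show "AE s in lebesgue_on {a<..<b}. norm (inner (f s) (c' s)) \<le> M * B"
      using M AE_space
    proof eventually_elim
      case (elim s)
      then have s: "norm (c' s) \<le> B" 
        using B[of s] c'_eq[of s] by auto
      have "\<bar>inner (f s) (c' s)\<bar> \<le> norm (f s) * norm (c' s)"
        by (rule Cauchy_Schwarz_ineq2)
      also have "\<dots> \<le> M * B"
        using elim s by (intro mult_mono) (auto intro: order_trans[OF norm_ge_zero])
      finally show ?case by simp
    qed
  qed (rule borel_measurable_inner_continuous[OF f c'])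
  then have "(\<lambda>s. inner (f s) (c' s)) absolutely_integrable_on {a..b}"
    unfolding absolutely_integrable_on_Icc_iff_Ioo
    by (simp add: integrable_restrict_space set_integrable_def)
  then have "(\<lambda>s. inner (f s) (c' s)) absolutely_integrable_on {a..t}"
    by (rule set_integrable_subset) (use t in auto)
  then have "integrable (lebesgue_on {a..t}) (\<lambda>s. inner (f s) (c' s))"
    by (simp add: integrable_restrict_space set_integrable_def)
  then show ?thesis
    by (rule Bochner_Integration.integrable_cong[THEN iffD1, rotated -1]) (use t c'_eq in auto)
qed

section \<open>The pseudo-metric of stopped paths\<close>

text \<open>
  Stopping a fixed continuous path at a varying time is a continuous curve for the
  pseudo-metric. Membership in \<open>paths\<close> is not assumed: the path of pairs of two members of
  \<open>paths\<close> need not be extensional.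
\<close>

lemma d_inf_curve:
  fixes x :: "real \<Rightarrow> 'h::real_normed_vector"
  assumes x: "continuous_on {0..T} x" and t: "t \<in> {0..T}" and "0 < e"
  shows "\<exists>d>0. \<forall>s\<in>{0..T}. \<bar>t - s\<bar> < d \<longrightarrow> d_inf T (t, x) (s, x) < e"
proof -
  have "uniformly_continuous_on {0..T} x"
    using x by (intro compact_uniformly_continuous) auto
  then obtain d where d: "d > 0" 
    "\<And>r r'. r \<in> {0..T} \<Longrightarrow> r' \<in> {0..T} \<Longrightarrow> dist r' r < d \<Longrightarrow> dist (x r') (x r) < e / 2"
    using \<open>0 < e\<close> unfolding uniformly_continuous_on_def by (metis half_gt_zero)
  show ?thesis
  proof (intro exI[of _ "min d (e / 2)"] conjI ballI impI)
    fix s assume s: "s \<in> {0..T}" "\<bar>t - s\<bar> < min d (e / 2)"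
    have "(SUP r\<in>{0..T}. norm (x (min r t) - x (min r s))) \<le> e / 2"
    proof (rule cSUP_least)
      fix r assume r: "r \<in> {0..T}"
      have "dist (min r t) (min r s) < d"
        using s by (auto simp: dist_real_def)
      then have "dist (x (min r t)) (x (min r s)) < e / 2"
        using r s t by (intro d) auto
      then show "norm (x (min r t) - x (min r s)) \<le> e / 2"
        by (simp add: dist_norm)
    qed (use t in auto)
    then show "d_inf T (t, x) (s, x) < e"
      using s by (simp add: d_inf_def)
  qed (use d \<open>0 < e\<close> in auto)
qed

text \<open>
  Paths that agree up to time \<open>t\<close> are at distance \<open>0\<close> at time \<open>t\<close>; continuous functions therefore take
  the same value at both (they are non-anticipating).
\<close>

lemma d_inf_eq_stopped:
  fixes x y :: "real \<Rightarrow> 'h::real_normed_vector"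
  assumes "0 \<le> T" "\<And>s. s \<in> {0..t} \<Longrightarrow> x s = y s" "0 \<le> t"
  shows "d_inf T (t, x) (t, y) = 0"
proof -
  have "(SUP r\<in>{0..T}. norm (x (min r t) - y (min r t))) = (SUP r\<in>{0..T}. 0)"
    using assms by (intro SUP_cong) auto
  then show ?thesis
    using assms by (simp add: d_inf_def)
qed

lemma pm_continuous_eqI:
  assumes f: "pm_continuous d D f" and "a \<in> D" "b \<in> D" "d a b = 0"
  shows "f a = f b"
proof -
  have "dist (f b) (f a) < e" if "e > 0" for e
    using f assms(2-) that unfolding pm_continuous_def by force
  then show ?thesis
    by (metis dist_eq_0_iff less_irrefl zero_less_dist_iff)
qed

lemma pm_continuous_along_curve:
  fixes c :: "real \<Rightarrow> 'a"
  assumes f: "pm_continuous d D f" and "c ` I \<subseteq> D"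
    and c: "\<And>t e. t \<in> I \<Longrightarrow> 0 < e \<Longrightarrow> \<exists>\<delta>>0. \<forall>s\<in>I. \<bar>t - s\<bar> < \<delta> \<longrightarrow> d (c t) (c s) < e"
  shows "continuous_on I (\<lambda>s. f (c s))"
  unfolding continuous_on_iff
proof (intro ballI allI impI)
  fix t e :: real assume te: "t \<in> I" "0 < e"
  then obtain \<eta> where \<eta>: "\<eta> > 0" "\<And>b. b \<in> D \<Longrightarrow> d (c t) b < \<eta> \<Longrightarrow> dist (f b) (f (c t)) < e"
    using f assms(2) unfolding pm_continuous_def by (metis image_subset_iff)
  obtain \<delta> where \<delta>: "\<delta> > 0" "\<And>s. s \<in> I \<Longrightarrow> \<bar>t - s\<bar> < \<delta> \<Longrightarrow> d (c t) (c s) < \<eta>"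
    using c[OF te(1) \<eta>(1)] by blast
  show "\<exists>\<delta>>0. \<forall>s\<in>I. dist s t < \<delta> \<longrightarrow> dist (f (c s)) (f (c t)) < e"
  proof (intro exI[of _ \<delta>] conjI ballI impI)
    fix s assume "s \<in> I" "dist s t < \<delta>"
    then show "dist (f (c s)) (f (c t)) < e"
      using \<delta> \<eta> assms(2) by (auto simp: dist_real_def abs_minus_commute)
  qed (use \<delta> in auto)
qed

lemma continuous_on_F_along:
  assumes "pm_continuous (d_inf_vec T) ({0..T} \<times> paths T \<times> UNIV) (\<lambda>(t, x, z). F t x z)"
    and x: "x \<in> paths T" and "0 \<le> t0"
  shows "continuous_on {t0..T} (\<lambda>s. F s x z)"
proof -
  have "continuous_on {t0..T} (\<lambda>s. (\<lambda>(t, x, z). F t x z) (s, x, z))"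
  proof (rule pm_continuous_along_curve[OF assms(1)])
    fix t e :: real assume "t \<in> {t0..T}" "0 < e"
    then show "\<exists>\<delta>>0. \<forall>s\<in>{t0..T}. \<bar>t - s\<bar> < \<delta> \<longrightarrow> d_inf_vec T (t, x, z) (s, x, z) < e"
      using d_inf_curve[of T x t e] x \<open>0 \<le> t0\<close> by (fastforce simp: d_inf_vec_def paths_def)
  qed (use assms in auto)
  then show ?thesis by simp
qed

lemma continuous_on_pair_along:
  assumes "pm_continuous (d_inf_pair T) ({t0..T} \<times> paths T \<times> paths T) (\<lambda>(t, x, y). \<psi> t x y)"
    and x: "x \<in> paths T" and y: "y \<in> paths T" and "0 \<le> t0"
  shows "continuous_on {t0..T} (\<lambda>s. \<psi> s x y)"
proof -
  have "continuous_on {t0..T} (\<lambda>s. (\<lambda>(t, x, y). \<psi> t x y) (s, x, y))"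
  proof (rule pm_continuous_along_curve[OF assms(1)])
    fix t e :: real assume "t \<in> {t0..T}" "0 < e"
    moreover have "continuous_on {0..T} (\<lambda>r. (x r, y r))"
      using x y by (auto simp: paths_def intro: continuous_intros)
    ultimately show "\<exists>\<delta>>0. \<forall>s\<in>{t0..T}. \<bar>t - s\<bar> < \<delta> \<longrightarrow> d_inf_pair T (t, x, y) (s, x, y) < e"
      using d_inf_curve[of T "\<lambda>r. (x r, y r)" t e] \<open>0 \<le> t0\<close> by (fastforce simp: d_inf_pair_def)
  qed (use assms in auto)
  then show ?thesis by simp
qed

lemma F_eq_stopped:
  assumes "pm_continuous (d_inf_vec T) ({0..T} \<times> paths T \<times> UNIV) (\<lambda>(t, x, z). F t x z)"
    and "x \<in> paths T" "x0 \<in> paths T" "t0 \<in> {0..T}" "\<And>s. s \<in> {0..t0} \<Longrightarrow> x s = x0 s"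
  shows "F t0 x z = F t0 x0 z"
  using pm_continuous_eqI[OF assms(1), of "(t0, x, z)" "(t0, x0, z)"] assms(2-)
    d_inf_eq_stopped[of T t0 x x0]
  by (simp add: d_inf_vec_def)

lemma pair_eq_stopped:
  assumes "pm_continuous (d_inf_pair T) ({t0..T} \<times> paths T \<times> paths T) (\<lambda>(t, x, y). \<psi> t x y)"
    and "x \<in> paths T" "x0 \<in> paths T" "y \<in> paths T" "y0 \<in> paths T" "t0 \<in> {0..T}"
    and "\<And>s. s \<in> {0..t0} \<Longrightarrow> x s = x0 s" "\<And>s. s \<in> {0..t0} \<Longrightarrow> y s = y0 s"
  shows "\<psi> t0 x y = \<psi> t0 x0 y0"
  using pm_continuous_eqI[OF assms(1), of "(t0, x, y)" "(t0, x0, y0)"] assms(2-)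
    d_inf_eq_stopped[of T t0 "\<lambda>r. (x r, y r)" "\<lambda>r. (x0 r, y0 r)"]
  by (simp add: d_inf_pair_def)

section \<open>Semicontinuity of the doubled function\<close>

lemma bdd_above_stopped_difference:
  fixes x x' :: "real \<Rightarrow> 'h::real_normed_vector"
  assumes "continuous_on {0..T} x" "continuous_on {0..T} x'" "t \<in> {0..T}" "s \<in> {0..T}"
  shows "bdd_above ((\<lambda>r. norm (x (min r t) - x' (min r s))) ` {0..T})"
proof -
  have "continuous_on {0..T} (\<lambda>r. norm (x (min r t) - x' (min r s)))"
    by (intro continuous_intros continuous_on_compose2[OF assms(1)] continuous_on_compose2[OF assms(2)])
       (use assms in auto)
  then show ?thesis
    by (intro bounded_imp_bdd_above compact_imp_bounded compact_continuous_image) auto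
qed

lemma d_inf_le_pair:
  fixes x y x' y' :: "real \<Rightarrow> 'h::real_normed_vector"
  assumes "x \<in> paths T" "y \<in> paths T" "x' \<in> paths T" "y' \<in> paths T" "t \<in> {0..T}" "s \<in> {0..T}"
  shows "d_inf T (t, x) (s, x') \<le> d_inf_pair T (t, x, y) (s, x', y')"
    and "d_inf T (t, y) (s, y') \<le> d_inf_pair T (t, x, y) (s, x', y')"
proof -
  have "bdd_above ((\<lambda>r. norm ((x (min r t), y (min r t)) - (x' (min r s), y' (min r s)))) ` {0..T})"
    using assms by (intro bdd_above_stopped_difference[of T "\<lambda>r. (x r, y r)" "\<lambda>r. (x' r, y' r)"])
      (auto simp: paths_def intro: continuous_intros)
  moreover have "norm (a - a') \<le> norm ((a, b) - (a', b'))" "norm (b - b') \<le> norm ((a, b) - (a', b'))"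
    for a a' b b' :: 'h
    by (auto simp: norm_prod_def intro: real_le_rsqrt)
  ultimately show "d_inf T (t, x) (s, x') \<le> d_inf_pair T (t, x, y) (s, x', y')"
    and "d_inf T (t, y) (s, y') \<le> d_inf_pair T (t, x, y) (s, x', y')"
    using assms unfolding d_inf_def d_inf_pair_def by (auto intro!: cSUP_subset_mono)
qed

lemma pm_usc_difference_doubled:
  assumes u: "pm_usc (d_inf T) ({0..T} \<times> \<Omega>) (\<lambda>(t, x). u t x)"
    and v: "pm_lsc (d_inf T) ({0..T} \<times> \<Omega>) (\<lambda>(t, x). v t x)"
    and \<Omega>: "\<Omega> \<subseteq> paths T"
  shows "pm_usc (d_inf_pair T) ({0..T} \<times> \<Omega> \<times> \<Omega>) (\<lambda>(t, x, y). u t x - v t y)"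
  unfolding pm_usc_def
proof (intro ballI allI impI)
  fix a and e :: real assume "a \<in> {0..T} \<times> \<Omega> \<times> \<Omega>" "0 < e"
  then obtain t x y where a: "a = (t, x, y)" "t \<in> {0..T}" "x \<in> \<Omega>" "y \<in> \<Omega>" by auto
  obtain d1 where d1: "d1 > 0"
    "\<And>s x'. s \<in> {0..T} \<Longrightarrow> x' \<in> \<Omega> \<Longrightarrow> d_inf T (t, x) (s, x') < d1 \<Longrightarrow> u s x' < u t x + e / 2"
  proof -
    have "\<exists>\<delta>>0. \<forall>b\<in>{0..T} \<times> \<Omega>. d_inf T (t, x) b < \<delta> \<longrightarrow>
            (case b of (t, x) \<Rightarrow> u t x) < (case (t, x) of (t, x) \<Rightarrow> u t x) + e / 2"
      using u a half_gt_zero[OF \<open>0 < e\<close>] unfolding pm_usc_def by blast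
    then show thesis using that by fastforce
  qed
  obtain d2 where d2: "d2 > 0"
    "\<And>s y'. s \<in> {0..T} \<Longrightarrow> y' \<in> \<Omega> \<Longrightarrow> d_inf T (t, y) (s, y') < d2 \<Longrightarrow> v s y' > v t y - e / 2"
  proof -
    have "\<exists>\<delta>>0. \<forall>b\<in>{0..T} \<times> \<Omega>. d_inf T (t, y) b < \<delta> \<longrightarrow>
            (case b of (t, y) \<Rightarrow> v t y) > (case (t, y) of (t, y) \<Rightarrow> v t y) - e / 2"
      using v a half_gt_zero[OF \<open>0 < e\<close>] unfolding pm_lsc_def by blast
    then show thesis using that by fastforce
  qed
  show "\<exists>\<delta>>0. \<forall>b\<in>{0..T} \<times> \<Omega> \<times> \<Omega>. d_inf_pair T a b < \<delta> \<longrightarrow>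
          (case b of (t, x, y) \<Rightarrow> u t x - v t y) < (case a of (t, x, y) \<Rightarrow> u t x - v t y) + e"
  proof (intro exI[of _ "min d1 d2"] conjI ballI impI)
    fix b assume b: "b \<in> {0..T} \<times> \<Omega> \<times> \<Omega>" "d_inf_pair T a b < min d1 d2"
    then obtain s x' y' where b': "b = (s, x', y')" "s \<in> {0..T}" "x' \<in> \<Omega>" "y' \<in> \<Omega>" by auto
    have "u s x' < u t x + e / 2" "v s y' > v t y - e / 2"
      using d1(2)[of s x'] d2(2)[of s y'] d_inf_le_pair[of x T y x' y' t s] a b b' subsetD[OF \<Omega>] by auto
    then show "(case b of (t, x, y) \<Rightarrow> u t x - v t y) < (case a of (t, x, y) \<Rightarrow> u t x - v t y) + e"
      using a b' by simp
  qed (use d1 d2 in auto)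
qed

section \<open>Test functions along trajectories\<close>

lemma bounded_path:
  assumes "x \<in> paths T"
  obtains B where "\<And>s. s \<in> {0..T} \<Longrightarrow> norm (x s) \<le> B"
proof -
  have "bounded (x ` {0..T})"
    using assms by (intro compact_imp_bounded compact_continuous_image) (auto simp: paths_def)
  then show thesis
    using that unfolding bounded_iff by blast
qed

lemma trajectory_forcing_bounded:
  assumes tr: "trajectory T p q j A L t0 x0 x X f" and "0 \<le> t0" and "0 \<le> L"
  obtains M where "0 \<le> M" "AE s in lebesgue_on {t0<..<T}. norm (f s) \<le> M"
proof -
  have "x \<in> paths T"
    using tr by (simp add: trajectory_def)
  then obtain B where B: "\<And>s. s \<in> {0..T} \<Longrightarrow> norm (x s) \<le> B"
    using bounded_path by blast
  have "AE s in lebesgue_on {t0<..<T}. norm (f s) \<le> L * (1 + (SUP r\<in>{0..s}. norm (x r)))"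
    using tr by (simp add: trajectory_def)
  \<comment> \<open>The absolute value only serves to make the bound nonnegative by inspection.\<close>
  then have "AE s in lebesgue_on {t0<..<T}. norm (f s) \<le> \<bar>L * (1 + B)\<bar>"
    using AE_space
  proof eventually_elim
    case (elim s)
    then have "(SUP r\<in>{0..s}. norm (x r)) \<le> B"
      using B \<open>0 \<le> t0\<close> by (intro cSUP_least) auto
    then have "L * (1 + (SUP r\<in>{0..s}. norm (x r))) \<le> L * (1 + B)"
      using \<open>0 \<le> L\<close> by (intro mult_left_mono) auto
    then show ?case using elim by linarith
  qed
  then show thesis
    by (intro that[of "\<bar>L * (1 + B)\<bar>"]) auto
qed

text \<open>
  The equation \<open>x' + A(x) = h\<close> in the dual space, tested with an element \<open>w\<close> of \<open>H\<close> that lies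
  in \<open>V\<close>.
\<close>

lemma generalized_derivative_on_test_vector:
  assumes j: "bounded_linear j" and "G + B = H_to_dual j h" and "w \<in> range j"
  shows "blinfun_apply G (inv j w) = inner h w - blinfun_apply B (inv j w)"
proof -
  have "bounded_linear (\<lambda>v. inner h (j v))"
    by (rule bounded_linear_compose[OF bounded_linear_inner_right j])
  then have "blinfun_apply (H_to_dual j h) (inv j w) = inner h w"
    using \<open>w \<in> range j\<close> by (simp add: H_to_dual_def bounded_linear_Blinfun_apply f_inv_into_f)
  then show ?thesis
    using assms(2) by (metis add_diff_cancel_right' blinfun.add_left)
qed

lemma C11V_derivatives_continuous:
  assumes "C11V T p q j t0 \<phi> \<phi>t \<phi>x \<phi>y"
  shows "pm_continuous (d_inf_pair T) ({t0..T} \<times> paths T \<times> paths T) (\<lambda>(t, x, y). \<phi>t t x y)"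
    and "pm_continuous (d_inf_pair T) ({t0..T} \<times> paths T \<times> paths T) (\<lambda>(t, x, y). \<phi>x t x y)"
    and "pm_continuous (d_inf_pair T) ({t0..T} \<times> paths T \<times> paths T) (\<lambda>(t, x, y). \<phi>y t x y)"
  using assms by (simp_all only: C11V_def Let_def)

text \<open>
  The chain rule in the definition of a test function, with the time derivatives eliminated through
  the evolution equations. The integral of the \<open>A\<close>-terms (\<open>K\<close>) is separated from a remainder \<open>R\<close>
  that involves the forcing terms.
\<close>

lemma chain_rule_along_trajectories:
  assumes j: "bounded_linear j" and t0: "0 \<le> t0" "t0 < T" and L: "0 \<le> L"
    and trx: "trajectory T p q j A L t0 x0 x X f" and tr_y: "trajectory T p q j A L t0 y0 y Y g"
    and paths0: "x0 \<in> paths T" "y0 \<in> paths T"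
    and C: "C11V T p q j t0 \<phi> \<phi>t \<phi>x \<phi>y" and t: "t \<in> {t0..T}"
  defines "K \<equiv> \<lambda>s. - blinfun_apply (A s (X s)) (inv j (\<phi>x s x y)) - blinfun_apply (A s (Y s)) (inv j (\<phi>y s x y))"
    and "R \<equiv> \<lambda>s. \<phi>t s x y + inner (f s) (\<phi>x s x y) + inner (g s) (\<phi>y s x y)"
  shows "integrable (lebesgue_on {t0..t}) R"
    and "\<phi> t x y - \<phi> t0 x0 y0 = integral\<^sup>L (lebesgue_on {t0..t}) K + integral\<^sup>L (lebesgue_on {t0..t}) R"
proof -
  have px: "x \<in> paths T" and py: "y \<in> paths T"
    using trx tr_y by (auto simp: trajectory_def)
  have cont: "continuous_on {t0..T} (\<lambda>s. \<phi>t s x y)" "continuous_on {t0..T} (\<lambda>s. \<phi>x s x y)"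
    "continuous_on {t0..T} (\<lambda>s. \<phi>y s x y)"
    using C11V_derivatives_continuous[OF C, THEN continuous_on_pair_along, OF px py t0(1)] .
  obtain M N where M: "AE s in lebesgue_on {t0<..<T}. norm (f s) \<le> M"
    and N: "AE s in lebesgue_on {t0<..<T}. norm (g s) \<le> N"
    using trajectory_forcing_bounded[OF trx] trajectory_forcing_bounded[OF tr_y] t0 L by metis
  have "f \<in> borel_measurable (lebesgue_on {t0<..<T})" "g \<in> borel_measurable (lebesgue_on {t0<..<T})"
    using trx tr_y by (auto simp: trajectory_def Lp_fun_def)
  then show R: "integrable (lebesgue_on {t0..t}) R"
    unfolding R_def using cont M N t
    by (intro Bochner_Integration.integrable_add integrable_inner_continuous integrable_continuous_lebesgue_on)
      (auto intro: continuous_on_subset)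
  obtain GX GY where G: "Wpq T p q j t0 X GX" "Wpq T p q j t0 Y GY"
    and eqX: "AE s in lebesgue_on {t0<..<T}. GX s + A s (X s) = H_to_dual j (f s)"
    and eqY: "AE s in lebesgue_on {t0<..<T}. GY s + A s (Y s) = H_to_dual j (g s)"
    using trx tr_y by (auto simp: trajectory_def)
  \<comment> \<open>The integrand of the chain rule, with the generalized derivatives.\<close>
  define ch where "ch s = \<phi>t s x y + blinfun_apply (GX s) (inv j (\<phi>x s x y))
                                 + blinfun_apply (GY s) (inv j (\<phi>y s x y))" for s
  have xX: "AE s in lebesgue_on {t0<..<T}. x s = j (X s)" "AE s in lebesgue_on {t0<..<T}. y s = j (Y s)"
    using trx tr_y by (auto simp: trajectory_def)
  have init: "\<forall>t\<in>{0..t0}. x t = x0 t \<and> y t = y0 t"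
    using trx tr_y by (auto simp: trajectory_def)
  have "AE s in lebesgue_on {t0<..<T}. x s = j (X s) \<and> y s = j (Y s)"
    using xX by eventually_elim simp
  then have ch: "integrable (lebesgue_on {t0..t}) ch"
    "\<phi> t x y - \<phi> t0 x0 y0 = integral\<^sup>L (lebesgue_on {t0..t}) ch"
    using C[unfolded C11V_def Let_def, THEN conjunct2, THEN conjunct2, rule_format,
        of t0 x0 y0 x y X GX Y GY t] G init px py paths0 t t0
    unfolding ch_def by auto
  have "AE s in lebesgue_on {t0<..<T}. (x s \<in> range j \<longrightarrow> \<phi>x s x y \<in> range j) \<and> (y s \<in> range j \<longrightarrow> \<phi>y s x y \<in> range j)"
    using C[unfolded C11V_def, THEN conjunct2, THEN conjunct1] px py by blast
  with eqX eqY xX have "AE s in lebesgue_on {t0<..<T}. K s = ch s - R s"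
  proof eventually_elim
    case (elim s)
    then have "\<phi>x s x y \<in> range j" "\<phi>y s x y \<in> range j" by auto
    then show ?case
      using elim generalized_derivative_on_test_vector[OF j, of "GX s" "A s (X s)" "f s" "\<phi>x s x y"]
        generalized_derivative_on_test_vector[OF j, of "GY s" "A s (Y s)" "g s" "\<phi>y s x y"]
      by (simp add: K_def ch_def R_def)
  qed
  then have "AE s in lebesgue_on {t0..t}. K s = ch s - R s"
    by (rule AE_lebesgue_on_Icc) (use t in auto)
  then have "integral\<^sup>L (lebesgue_on {t0..t}) K = integral\<^sup>L (lebesgue_on {t0..t}) (\<lambda>s. ch s - R s)"
    by (intro integrable_lebesgue_on_cong_AE(2)) (use ch R in auto)
  then show "\<phi> t x y - \<phi> t0 x0 y0 = integral\<^sup>L (lebesgue_on {t0..t}) K + integral\<^sup>L (lebesgue_on {t0..t}) R"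
    using ch R by simp
qed

section \<open>The viscosity inequality\<close>

lemma Limsup_ge_of_eventually:
  fixes f :: "real \<Rightarrow> real"
  assumes "\<And>e. e > 0 \<Longrightarrow> \<forall>\<^sub>F \<delta> in at_right 0. - a - e \<le> f \<delta>"
  shows "- ereal a \<le> Limsup (at_right 0) (\<lambda>\<delta>. ereal (f \<delta>))"
proof (rule ereal_le_epsilon2)
  fix e :: real assume "0 < e"
  have "\<forall>\<^sub>F \<delta> in at_right 0. ereal (- a - e) \<le> ereal (f \<delta>)"
    using assms[OF \<open>0 < e\<close>] by simp
  then have "ereal (- a - e) \<le> Limsup (at_right 0) (\<lambda>\<delta>. ereal (f \<delta>))"
    using Liminf_bounded Liminf_le_Limsup order_trans trivial_limit_at_right_real by metis
  then show "- ereal a \<le> Limsup (at_right 0) (\<lambda>\<delta>. ereal (f \<delta>)) + ereal e"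
    using add_right_mono[of "ereal (- a - e)" _ "ereal e"] by simp
qed

text \<open>
  The averages over \<open>[t\<^sub>0, t\<^sub>0 + \<delta>]\<close> of a continuous function tend to its value at \<open>t\<^sub>0\<close>; only the lower
  bound is needed, and only for a function \<open>k\<close> that dominates the integrals.
\<close>

lemma eventually_average_ge:
  assumes t0: "t0 < T0" "T0 \<le> T" and c: "continuous_on {t0..T} c" and b: "b < c t0"
    and int: "\<And>t. t \<in> {t0..T0} \<Longrightarrow> (LINT s|lebesgue_on {t0..t}. c s) \<le> k t"
  shows "\<forall>\<^sub>F \<delta> in at_right 0. b \<le> 1 / \<delta> * k (t0 + \<delta> :: real)"
proof -
  obtain d where d: "d > 0" "\<And>s. s \<in> {t0..T} \<Longrightarrow> dist s t0 < d \<Longrightarrow> dist (c s) (c t0) < c t0 - b"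
  proof -
    have "t0 \<in> {t0..T}" "0 < c t0 - b"
      using t0 b by auto
    then show thesis
      using c that unfolding continuous_on_iff by blast
  qed
  show ?thesis
    unfolding eventually_at_right[OF zero_less_one]
  proof (intro exI[of _ "min d (T0 - t0)"] conjI allI impI)
    fix \<delta> :: real assume \<delta>: "0 < \<delta>" "\<delta> < min d (T0 - t0)"
    have "b * \<delta> = (LINT s|lebesgue_on {t0..t0 + \<delta>}. b)"
      using \<delta> by (simp add: measure_restrict_space)
    also have "\<dots> \<le> (LINT s|lebesgue_on {t0..t0 + \<delta>}. c s)"
    proof (rule integral_mono)
      show "integrable (lebesgue_on {t0..t0 + \<delta>}) c"
        using c \<delta> t0 by (intro integrable_continuous_lebesgue_on) (auto intro: continuous_on_subset)
      fix s assume "s \<in> space (lebesgue_on {t0..t0 + \<delta>})"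
      then have "dist (c s) (c t0) < c t0 - b"
        using \<delta> t0 by (intro d) (auto simp: dist_real_def)
      then show "b \<le> c s" by (simp add: dist_real_def)
    qed (auto intro: integrable_continuous_lebesgue_on)
    also have "\<dots> \<le> k (t0 + \<delta>)"
      using \<delta> by (intro int) auto
    finally show "b \<le> 1 / \<delta> * k (t0 + \<delta>)"
      using \<delta> by (simp add: field_simps)
  qed (use d t0 in auto)
qed

text \<open>
  The comparison of the minimax inequalities with the chain rule, for arbitrary directions \<open>z\<close>
  and \<open>z'\<close>. The constants \<open>M\<close>, \<open>N\<close> bound the forcing terms; the integrand on the left is a continuous
  function of \<open>s\<close>.
\<close>

lemma touching_difference_integral_bound:
  assumes j: "bounded_linear j" and t0: "0 \<le> t0" "t0 < T" and L: "0 \<le> L"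
    and F: "pm_continuous (d_inf_vec T) ({0..T} \<times> paths T \<times> UNIV) (\<lambda>(t, x, z). F t x z)"
    and paths0: "x0 \<in> paths T" "y0 \<in> paths T"
    and trx: "trajectory T p q j A L t0 x0 x X f" and tr_y: "trajectory T p q j A L t0 y0 y Y g"
    and C: "C11V T p q j t0 \<phi> \<phi>t \<phi>x \<phi>y" and T0: "T0 \<le> T"
    and touch: "\<phi> t0 x0 y0 = u t0 x0 - v t0 y0"
    and above: "\<And>t. t \<in> {t0..T0} \<Longrightarrow> u t x - v t y \<le> \<phi> t x y"
    and u: "\<And>t. t \<in> {t0..T} \<Longrightarrow>
       u t0 x0 \<le> (LINT s|lebesgue_on {t0..t}. inner (- f s) z + F s x z) + u t x"
    and v: "\<And>t. t \<in> {t0..T} \<Longrightarrow>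
       v t0 y0 \<ge> (LINT s|lebesgue_on {t0..t}. inner (- g s) z' + F s y z') + v t y"
  obtains M N where "\<And>t. t \<in> {t0..T0} \<Longrightarrow>
    (LINT s|lebesgue_on {t0..t}. - M * norm (\<phi>x s x y - z) - N * norm (\<phi>y s x y + z')
        - F s x z + F s y z' - \<phi>t s x y)
    \<le> (LINT s|lebesgue_on {t0..t}. - blinfun_apply (A s (X s)) (inv j (\<phi>x s x y))
                                  - blinfun_apply (A s (Y s)) (inv j (\<phi>y s x y)))"
proof -
  have px: "x \<in> paths T" and py: "y \<in> paths T"
    using trx tr_y by (auto simp: trajectory_def)
  have cont: "continuous_on {t0..T} (\<lambda>s. \<phi>t s x y)" "continuous_on {t0..T} (\<lambda>s. \<phi>x s x y)"
    "continuous_on {t0..T} (\<lambda>s. \<phi>y s x y)"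
    using C11V_derivatives_continuous[OF C, THEN continuous_on_pair_along, OF px py t0(1)] .
  have contF: "continuous_on {t0..T} (\<lambda>s. F s x z)" "continuous_on {t0..T} (\<lambda>s. F s y z')"
    using continuous_on_F_along[OF F] px py t0 by auto
  obtain M where M: "0 \<le> M" "AE s in lebesgue_on {t0<..<T}. norm (f s) \<le> M"
    using trajectory_forcing_bounded[OF trx] t0 L by metis
  obtain N where N: "0 \<le> N" "AE s in lebesgue_on {t0<..<T}. norm (g s) \<le> N"
    using trajectory_forcing_bounded[OF tr_y] t0 L by metis
  have meas: "f \<in> borel_measurable (lebesgue_on {t0<..<T})" "g \<in> borel_measurable (lebesgue_on {t0<..<T})"
    using trx tr_y by (auto simp: trajectory_def Lp_fun_def)
  show thesis
  proof (rule that[of M N])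
    fix t assume t: "t \<in> {t0..T0}"
    then have tT: "t \<in> {t0..T}" using T0 by auto
    \<comment> \<open>\<open>a\<close> and \<open>b\<close> are the integrands of the minimax inequalities for \<open>u\<close> and \<open>v\<close>.\<close>
    define a where "a s = inner (- f s) z + F s x z" for s
    define b where "b s = inner (- g s) z' + F s y z'" for s
    define R where "R s = \<phi>t s x y + inner (f s) (\<phi>x s x y) + inner (g s) (\<phi>y s x y)" for s
    define c where "c = (\<lambda>s. - M * norm (\<phi>x s x y - z) - N * norm (\<phi>y s x y + z')
        - F s x z + F s y z' - \<phi>t s x y)"
    let ?K = "\<lambda>s. - blinfun_apply (A s (X s)) (inv j (\<phi>x s x y))
                 - blinfun_apply (A s (Y s)) (inv j (\<phi>y s x y))"
    let ?\<mu> = "lebesgue_on {t0..t}"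
    have a: "integrable ?\<mu> a" and b: "integrable ?\<mu> b"
      unfolding a_def b_def inner_minus_left
      by (intro Bochner_Integration.integrable_add Bochner_Integration.integrable_minus
          integrable_inner_continuous[OF meas(1) M(2)] integrable_inner_continuous[OF meas(2) N(2)]
          integrable_continuous_lebesgue_on continuous_on_const
          continuous_on_subset[OF contF(1)] continuous_on_subset[OF contF(2)] tT; use tT in auto)+
    have R: "integrable ?\<mu> R"
      and K: "\<phi> t x y - \<phi> t0 x0 y0 = integral\<^sup>L ?\<mu> ?K + integral\<^sup>L ?\<mu> R"
      unfolding R_def
      using chain_rule_along_trajectories[OF j t0 L trx tr_y paths0 C tT] by auto
    have "continuous_on {t0..T} c"
      unfolding c_def by (intro continuous_intros cont contF)
    then have c: "integrable ?\<mu> c"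
      by (intro integrable_continuous_lebesgue_on) (use tT in \<open>auto intro: continuous_on_subset\<close>)
    have "AE s in lebesgue_on {t0<..<T}. c s \<le> b s - a s - R s"
      using M(2) N(2)
    proof eventually_elim
      case (elim s)
      have "inner (f s) (\<phi>x s x y - z) \<le> M * norm (\<phi>x s x y - z)"
        using elim by (intro order_trans[OF norm_cauchy_schwarz] mult_right_mono) auto
      moreover have "inner (g s) (\<phi>y s x y + z') \<le> N * norm (\<phi>y s x y + z')"
        using elim by (intro order_trans[OF norm_cauchy_schwarz] mult_right_mono) auto
      ultimately show ?case
        by (simp add: a_def b_def c_def R_def inner_diff_right inner_add_right)
    qed
    then have "AE s in ?\<mu>. c s \<le> b s - a s - R s"
      by (rule AE_lebesgue_on_Icc) (use tT in auto)
    then have "integral\<^sup>L ?\<mu> c \<le> integral\<^sup>L ?\<mu> (\<lambda>s. b s - a s - R s)"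
      using a b c R by (intro integral_mono_AE) auto
    also have "\<dots> = integral\<^sup>L ?\<mu> b - integral\<^sup>L ?\<mu> a - integral\<^sup>L ?\<mu> R"
      using a b R by simp
    also have "\<dots> \<le> integral\<^sup>L ?\<mu> ?K"
      using K touch above[OF t] u[OF tT] v[OF tT] unfolding a_def b_def by linarith
    finally show "(LINT s|?\<mu>. - M * norm (\<phi>x s x y - z) - N * norm (\<phi>y s x y + z')
        - F s x z + F s y z' - \<phi>t s x y) \<le> integral\<^sup>L ?\<mu> ?K"
      unfolding c_def .
  qed
qed

theorem theorem4p3:
  fixes T p q L :: real
    and j :: "'v::banach \<Rightarrow> 'h::{real_inner,complete_space}"
    and A :: "real \<Rightarrow> 'v \<Rightarrow> 'v \<Rightarrow>\<^sub>L real"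
    and F :: "real \<Rightarrow> (real \<Rightarrow> 'h) \<Rightarrow> 'h \<Rightarrow> real"
    and h :: "(real \<Rightarrow> 'h) \<Rightarrow> real"
    and xstar :: 'h
    and \<Omega> :: "(real \<Rightarrow> 'h) set"
    and u v :: "real \<Rightarrow> (real \<Rightarrow> 'h) \<Rightarrow> real"
  assumes "T > 0"
    and "p \<ge> 2" and "q > 1" and "1 / p + 1 / q = 1"
    and "gelfand_embedding j"
    and "monotone_coercive_operator T p q A"
    and "pm_continuous (sup_dist T) (paths T) h"
    and "admissible_hamiltonian T p q j A F"
    and "L \<ge> 0"
    and "Omega T p q j A xstar L \<subseteq> \<Omega>" and "\<Omega> \<subseteq> paths T"
    and "minimax_subsolution T p q j A F h L \<Omega> u"
    and "minimax_supersolution T p q j A F h L \<Omega> v"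
  shows "viscosity_subsolution_doubled T p q j A F L \<Omega> (\<lambda>t x y. u t x - v t y)"
  unfolding viscosity_subsolution_doubled_def
proof (intro conjI ballI allI impI)
  show "pm_usc (d_inf_pair T) ({0..T} \<times> \<Omega> \<times> \<Omega>) (\<lambda>(t, x, y). u t x - v t y)"
    using assms(12)[unfolded minimax_subsolution_def, THEN conjunct1]
      assms(13)[unfolded minimax_supersolution_def, THEN conjunct1] assms(11)
    by (rule pm_usc_difference_doubled)
next
  fix t0 x0 y0 \<phi> \<phi>t \<phi>x \<phi>y
  assume t0: "t0 \<in> {0..<T}" and x0: "x0 \<in> \<Omega>" and y0: "y0 \<in> \<Omega>"
    and touching: "touching_above T p q j A L \<Omega> (\<lambda>t x y. u t x - v t y) t0 x0 y0 \<phi> \<phi>t \<phi>x \<phi>y"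
  have j: "bounded_linear j"
    using assms(5) by (simp add: gelfand_embedding_def)
  have F: "pm_continuous (d_inf_vec T) ({0..T} \<times> paths T \<times> UNIV) (\<lambda>(t, x, z). F t x z)"
    using assms(8) by (simp add: admissible_hamiltonian_def)
  have paths0: "x0 \<in> paths T" "y0 \<in> paths T"
    using x0 y0 assms(11) by auto
  have C: "C11V T p q j t0 \<phi> \<phi>t \<phi>x \<phi>y"
    using touching by (simp add: touching_above_def)
  define z where "z = \<phi>x t0 x0 y0"
  define z' where "z' = - \<phi>y t0 x0 y0"
  obtain x X f where trx: "trajectory T p q j A L t0 x0 x X f" "x \<in> \<Omega>"
    and u: "\<And>t. t \<in> {t0..T} \<Longrightarrow>
       u t0 x0 \<le> (LINT s|lebesgue_on {t0..t}. inner (- f s) z + F s x z) + u t x"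
    using assms(12)[unfolded minimax_subsolution_def, THEN conjunct2, THEN conjunct2, rule_format, OF t0 x0, of z]
    by blast
  obtain y Y g where tr_y: "trajectory T p q j A L t0 y0 y Y g" "y \<in> \<Omega>"
    and v: "\<And>t. t \<in> {t0..T} \<Longrightarrow>
       v t0 y0 \<ge> (LINT s|lebesgue_on {t0..t}. inner (- g s) z' + F s y z') + v t y"
    using assms(13)[unfolded minimax_supersolution_def, THEN conjunct2, THEN conjunct2, rule_format, OF t0 y0, of z']
    by blast
  obtain T0 where T0: "T0 \<in> {t0<..T}" and touch: "\<phi> t0 x0 y0 = u t0 x0 - v t0 y0"
    and inf: "(INF (t, x, y) \<in> {t0..T0} \<times> (trajectories T p q j A L t0 x0 \<inter> \<Omega>)
                                 \<times> (trajectories T p q j A L t0 y0 \<inter> \<Omega>).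
           ereal (\<phi> t x y - (u t x - v t y))) = 0"
    using touching unfolding touching_above_def by (elim conjE bexE) (rule that; simp)
  have t0': "0 \<le> t0" "t0 < T" "T0 \<le> T"
    using t0 T0 by auto
  have above: "u t x - v t y \<le> \<phi> t x y" if "t \<in> {t0..T0}" for t
  proof -
    have "0 \<le> ereal (\<phi> t x y - (u t x - v t y))"
      unfolding inf[symmetric]
      by (rule INF_lower2[of "(t, x, y)"]) (use that trx tr_y in \<open>auto simp: trajectories_def\<close>)
    then show ?thesis by simp
  qed
  let ?K = "\<lambda>s. - blinfun_apply (A s (X s)) (inv j (\<phi>x s x y)) - blinfun_apply (A s (Y s)) (inv j (\<phi>y s x y))"
  obtain M N where MN: "\<And>t. t \<in> {t0..T0} \<Longrightarrow>
    (LINT s|lebesgue_on {t0..t}. - M * norm (\<phi>x s x y - z) - N * norm (\<phi>y s x y + z')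
        - F s x z + F s y z' - \<phi>t s x y) \<le> (LINT s|lebesgue_on {t0..t}. ?K s)"
    using touching_difference_integral_bound[where u = u and v = v and z = z and z' = z',
        OF j t0'(1,2) \<open>L \<ge> 0\<close> F paths0 trx(1) tr_y(1) C t0'(3) touch above u v] by blast
  define c where "c = (\<lambda>s. - M * norm (\<phi>x s x y - z) - N * norm (\<phi>y s x y + z')
        - F s x z + F s y z' - \<phi>t s x y)"
  define a where "a = \<phi>t t0 x0 y0 + F t0 x0 z - F t0 y0 z'"
  have p: "x \<in> paths T" "y \<in> paths T" "\<And>s. s \<in> {0..t0} \<Longrightarrow> x s = x0 s" "\<And>s. s \<in> {0..t0} \<Longrightarrow> y s = y0 s"
    using trx(1) tr_y(1) unfolding trajectory_def by blast+
  have C': "pm_continuous (d_inf_pair T) ({t0..T} \<times> paths T \<times> paths T) (\<lambda>(t, x, y). \<phi>t t x y)"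
    "pm_continuous (d_inf_pair T) ({t0..T} \<times> paths T \<times> paths T) (\<lambda>(t, x, y). \<phi>x t x y)"
    "pm_continuous (d_inf_pair T) ({t0..T} \<times> paths T \<times> paths T) (\<lambda>(t, x, y). \<phi>y t x y)"
    using C11V_derivatives_continuous[OF C] .
  have "\<phi>t t0 x y = \<phi>t t0 x0 y0" "\<phi>x t0 x y = z" "\<phi>y t0 x y = - z'"
    using C'[THEN pair_eq_stopped, OF p(1) paths0(1) p(2) paths0(2) _ p(3,4)] t0'
    by (auto simp: z_def z'_def)
  moreover have "F t0 x z = F t0 x0 z" "F t0 y z' = F t0 y0 z'"
    using F_eq_stopped[OF F p(1) paths0(1) _ p(3)] F_eq_stopped[OF F p(2) paths0(2) _ p(4)] t0'
    by auto
  ultimately have c_t0: "c t0 = - a"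
    by (simp add: c_def a_def)
  have c: "continuous_on {t0..T} c"
    unfolding c_def
    by (intro continuous_intros C'[THEN continuous_on_pair_along, OF p(1,2) t0'(1)]
        continuous_on_F_along[OF F _ t0'(1)] p(1,2))
  \<comment> \<open>The integrals of the \<open>A\<close>-terms dominate those of \<open>c\<close>, so the averages are asymptotically at least \<open>c t0 = - a\<close>.\<close>
  have "- ereal a \<le> Limsup (at_right 0) (\<lambda>\<delta>. ereal (1 / \<delta> * (LINT s|lebesgue_on {t0..t0 + \<delta>}. ?K s)))"
  proof (rule Limsup_ge_of_eventually)
    fix e :: real assume "0 < e"
    then have "- a - e < c t0"
      using c_t0 by simp
    moreover have "t0 < T0"
      using T0 by simp
    ultimately show "\<forall>\<^sub>F \<delta> in at_right 0. - a - e \<le> 1 / \<delta> * (LINT s|lebesgue_on {t0..t0 + \<delta>}. ?K s)"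
      using MN[folded c_def] t0'(3) c
      by (intro eventually_average_ge[where c = c and k = "\<lambda>t. LINT s|lebesgue_on {t0..t}. ?K s"])
  qed
  then have "0 \<le> ereal (\<phi>t t0 x0 y0)
           + Limsup (at_right 0) (\<lambda>\<delta>. ereal (1 / \<delta> * (LINT t|lebesgue_on {t0..t0 + \<delta>}. ?K t)))
           + ereal (F t0 x0 (\<phi>x t0 x0 y0)) - ereal (F t0 y0 (- \<phi>y t0 x0 y0))"
    by (cases "Limsup (at_right 0) (\<lambda>\<delta>. ereal (1 / \<delta> * (LINT t|lebesgue_on {t0..t0 + \<delta>}. ?K t)))")
      (auto simp: a_def z_def z'_def)
  then show "\<exists>x X f y Y g.
           trajectory T p q j A L t0 x0 x X f \<and> trajectory T p q j A L t0 y0 y Y g \<and>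
           ereal (\<phi>t t0 x0 y0)
           + Limsup (at_right 0) (\<lambda>\<delta>. ereal (1 / \<delta> * (LINT t|lebesgue_on {t0..t0 + \<delta>}.
               - blinfun_apply (A t (X t)) (inv j (\<phi>x t x y))
               - blinfun_apply (A t (Y t)) (inv j (\<phi>y t x y)))))
           + ereal (F t0 x0 (\<phi>x t0 x0 y0)) - ereal (F t0 y0 (- \<phi>y t0 x0 y0)) \<ge> 0"
    by (intro exI conjI) (rule trx(1), rule tr_y(1))
qed

end
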